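(* Let $(\mathscr{W},\rho)$ be a metric space (the model class), and let $\delta>0$. Assume: (1) the loss function $\ell$ takes values in a finite interval $[0,b]$; (2) for any $\delta>0$, $$H(\delta;\mathscr{W})=\sup_{n\ge1}\ \sup_{z^n}H_n(\delta;\mathscr{W},\rho_n)<\infty .$$ Then $$\mathsf{E}(\Delta_n(\mathscr{W}))\le\inf_{\delta>0}\left(2\delta+6b\sqrt{\frac{H(\delta;\mathscr{W})}{n}}\right).$$
   Context: Learning setup: $\mathscr{Z}$ is a data space, $\mathscr{W}$ a model class, $\ell:\mathscr{Z}\times\mathscr{W}\to[0,\infty)$ a loss function, and $Z,Z_1,\ldots,Z_n$ are i.i.d. from a probability distribution $p$ on $\mathscr{Z}$. The expected loss is $L(w)=\mathsf{E}(\ell(Z,w))$, the empirical loss is $L_n(w)=\frac1n\sum_{i=1}^n\ell(Z_i,w)$, and the worst-case generalization error is $\Delta_n(\mathscr{W})=\sup_{w\in\mathscr{W}}|L(w)-L_n(w)|$. For a fixed dataset outcome $z^n=(z_1,\ldots,z_n)\in\mathscr{Z}^n$, define the pseudometric on $\mathscr{W}$ $$\rho_n(w,w')=\Big(\frac1n\sum_{i=1}^n|\ell(z_i,w)-\ell(z_i,w')|^2\Big)^{1/2},$$ the data-dependent covering number $$N_n(\delta;\mathscr{W},\rho_n)=\min\Big\{N:\sup_{w\in\mathscr{W}}\min_{1\le j\le N}\rho_n(w,w_j)\le\delta\text{ for some }w_1,\ldots,w_N\in\mathscr{W}\Big\},$$ and the data-dependent metric entropy $H_n(\delta;\mathscr{W},\rho_n)=\log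 N_n(\delta;\mathscr{W},\rho_n)$, with $\log$ to base 2.
   Formalization: The infimum runs only over δ>0 with H(δ;W)>0 (for one-point classes with non-constant loss the bound fails); W is nonempty, ℓ(·,w), Δ_n and the suprema over w of |Σ e_i ℓ(z_i,w)| are assumed measurable, without which the bound can fail. *)

theory Defs
  imports "HOL-Probability.Probability"
begin

text \<open>
  A dataset outcome \<open>z\<^sub>1, \<dots>, z\<^sub>n\<close> is a function on the index set \<open>{1..n}\<close>; the data space is
  \<open>space p\<close>, and the model class is a carrier set \<open>W\<close>.
\<close>

definition expected_loss :: "'z measure \<Rightarrow> ('z \<Rightarrow> 'w \<Rightarrow> real) \<Rightarrow> 'w \<Rightarrow> real" where
  "expected_loss p l w = (\<integral>z. l z w \<partial>p)"

definition empirical_loss :: "('z \<Rightarrow> 'w \<Rightarrow> real) \<Rightarrow> nat \<Rightarrow> (nat \<Rightarrow> 'z) \<Rightarrow> 'w \<Rightarrow> real" where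
  "empirical_loss l n z w = (1 / real n) * (\<Sum>i=1..n. l (z i) w)"

definition gen_error ::
    "'z measure \<Rightarrow> ('z \<Rightarrow> 'w \<Rightarrow> real) \<Rightarrow> 'w set \<Rightarrow> nat \<Rightarrow> (nat \<Rightarrow> 'z) \<Rightarrow> real" where
  "gen_error p l W n z = (SUP w\<in>W. \<bar>expected_loss p l w - empirical_loss l n z w\<bar>)"

definition emp_dist ::
    "('z \<Rightarrow> 'w \<Rightarrow> real) \<Rightarrow> nat \<Rightarrow> (nat \<Rightarrow> 'z) \<Rightarrow> 'w \<Rightarrow> 'w \<Rightarrow> real" where
  "emp_dist l n z w w' = sqrt ((1 / real n) * (\<Sum>i=1..n. \<bar>l (z i) w - l (z i) w'\<bar>\<^sup>2))"

text \<open>The value is \<open>\<infinity>\<close> if there is no finite cover; the centres are required to lie in \<open>W\<close>.\<close>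

definition covering_number ::
    "('z \<Rightarrow> 'w \<Rightarrow> real) \<Rightarrow> 'w set \<Rightarrow> nat \<Rightarrow> (nat \<Rightarrow> 'z) \<Rightarrow> real \<Rightarrow> enat" where
  "covering_number l W n z \<delta> =
     Inf {enat N | N. 1 \<le> N \<and>
       (\<exists>c. (\<forall>j\<in>{1..N}. c j \<in> W) \<and>
            (SUP w\<in>W. MIN j\<in>{1..N}. ereal (emp_dist l n z w (c j))) \<le> ereal \<delta>)}"

definition metric_entropy ::
    "('z \<Rightarrow> 'w \<Rightarrow> real) \<Rightarrow> 'w set \<Rightarrow> nat \<Rightarrow> (nat \<Rightarrow> 'z) \<Rightarrow> real \<Rightarrow> ereal" where
  "metric_entropy l W n z \<delta> =
     (case covering_number l W n z \<delta> of enat N \<Rightarrow> ereal (log 2 (real N)) | \<infinity> \<Rightarrow> \<infinity>)"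

definition uniform_entropy ::
    "'z measure \<Rightarrow> ('z \<Rightarrow> 'w \<Rightarrow> real) \<Rightarrow> 'w set \<Rightarrow> real \<Rightarrow> ereal" where
  "uniform_entropy p l W \<delta> =
     (SUP n\<in>{1..}. SUP z\<in>({1..n} \<rightarrow>\<^sub>E space p). metric_entropy l W n z \<delta>)"

text \<open>
  If \<open>uniform_entropy p l W \<delta> = 0\<close> (covering number 1), the bound \<open>2 \<delta> + 6 b sqrt (H \<delta> / n)\<close>
  reads \<open>2 \<delta>\<close> and can fail: for a one-point class it would give expected error 0 for every
  loss.  The infimum in the main result therefore ranges over those \<open>\<delta> > 0\<close> with positive
  entropy, equivalently with covering number at least 2 for some dataset.
\<close>

text \<open>
  Suprema over an uncountable \<open>W\<close> need not be measurable, and symmetrization fails without some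
  measurability: on \<open>\<omega>\<^sub>1\<close> with the countable-cocountable \<open>\<sigma>\<close>-algebra, the law giving mass 0 to countable
  sets, and losses \<open>l z w = (if z \<le> w then 1 else 0)\<close>, the generalization error is identically 1
  although the entropy is finite.  The following is the usual notion of a \<open>p\<close>-measurable class.
\<close>

definition measurable_class :: "'z measure \<Rightarrow> ('z \<Rightarrow> 'w \<Rightarrow> real) \<Rightarrow> 'w set \<Rightarrow> bool" where
  "measurable_class p l W \<longleftrightarrow>
     (\<forall>w\<in>W. (\<lambda>z. l z w) \<in> borel_measurable p) \<and>
     (\<forall>m (e :: nat \<Rightarrow> real).
        (\<lambda>z. SUP w\<in>W. \<bar>\<Sum>i=1..m. e i * l (z i) w\<bar>) \<in> borel_measurable (PiM {1..m} (\<lambda>_. p)))"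

end

theory Submission
  imports Defs
begin

text \<open>
  Symmetrization with a ghost sample and random signs bounds the expected generalization error by
  twice the expected Rademacher average of the loss class.  For a fixed data set, passing to the
  \<open>N\<close> centres of a cover costs at most \<open>\<delta>\<close>, and the maximal inequality for \<open>N\<close> subgaussian
  variables bounds the rest by \<open>b sqrt (2 ln (2 N) / n)\<close>.  Entropies are logarithms of integers, so
  a positive entropy \<open>H\<close> is at least 1; this absorbs the additive constant in
  \<open>ln (2 N) \<le> ln 2 (1 + H)\<close>.  The signs range over the finite set \<open>{-1, 1}\<^sup>n\<close>, so their expectation
  is a finite average and needs no probability space of its own.
\<close>

section \<open>Rademacher averages of finite classes\<close>

declare One_nat_def [simp del]

text \<open>Extensionality makes a sign vector determined by its values on \<open>I\<close>, so for
  finite \<open>I\<close> there are exactly \<open>2 ^ card I\<close> of them.\<close>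

abbreviation sign_vectors :: "'i set \<Rightarrow> ('i \<Rightarrow> real) set" where
  "sign_vectors I \<equiv> I \<rightarrow>\<^sub>E {-1, 1}"

lemma card_sign_vectors: "finite I \<Longrightarrow> card (sign_vectors I) = 2 ^ card I"
  by (simp add: card_PiE card_insert_if flip: numeral_2_eq_2)

text \<open>The moment generating function of one random sign is \<open>cosh\<close>, so this is its
  subgaussian bound. It is the analytic inequality behind Hoeffding's lemma at \<open>2 * x\<close>
  with probability \<open>1/2\<close>; evenness of both sides covers negative
  \<open>x\<close>.\<close>

lemma cosh_le_exp_half_square: "cosh x \<le> exp (x\<^sup>2 / 2)" for x :: real
proof -
  have nonneg: "cosh x \<le> exp (x\<^sup>2 / 2)" if "x \<ge> 0" for x :: real
  proof -
    have eq: "1 + 1/2 * (exp (2 * x) - 1) = exp x * cosh x"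
      by (simp add: cosh_field_def field_simps flip: exp_add)
    have "ln (exp x * cosh x) = x + ln (cosh x)"
      by (simp add: ln_mult)
    moreover have "- (2 * x) * (1/2) + ln (exp x * cosh x) \<le> (2 * x)\<^sup>2 / 8"
      using Hoeffdings_lemma_aux[of "2 * x" "1/2"] that by (simp only: eq)
    ultimately have "ln (cosh x) \<le> x\<^sup>2 / 2"
      by (simp add: power_mult_distrib)
    then show ?thesis
      by (metis cosh_real_pos exp_ln exp_le_cancel_iff)
  qed
  show ?thesis
    using nonneg[of x] nonneg[of "- x"] by (cases "x \<ge> 0") auto
qed

text \<open>The signs are independent: the sum over all sign vectors of a product factorises into a
  product of two-term sums, each equal to \<open>2 * cosh (t * a i)\<close>.\<close>

lemma sum_sign_vectors_exp_le:
  assumes "finite I" and "\<And>i. i \<in> I \<Longrightarrow> \<bar>a i\<bar> \<le> (b::real)"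
  shows "(\<Sum>\<epsilon>\<in>sign_vectors I. exp (t * (\<Sum>i\<in>I. \<epsilon> i * a i)))
           \<le> 2 ^ card I * exp (t\<^sup>2 * real (card I) * b\<^sup>2 / 2)"
proof -
  have "(\<Sum>\<epsilon>\<in>sign_vectors I. exp (t * (\<Sum>i\<in>I. \<epsilon> i * a i)))
      = (\<Sum>\<epsilon>\<in>sign_vectors I. \<Prod>i\<in>I. exp (t * (\<epsilon> i * a i)))"
    using assms(1) by (simp add: sum_distrib_left exp_sum)
  also have "\<dots> = (\<Prod>i\<in>I. \<Sum>e\<in>{-1, 1}. exp (t * (e * a i)))"
    using assms(1) by (subst prod_sum_PiE) auto
  also have "\<dots> = (\<Prod>i\<in>I. 2 * cosh (t * a i))"
    by (intro prod.cong) (simp_all add: cosh_field_def add.commute)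
  also have "\<dots> \<le> (\<Prod>i\<in>I. 2 * exp (t\<^sup>2 * b\<^sup>2 / 2))"
  proof (rule prod_mono, safe)
    fix i assume "i \<in> I"
    have "\<bar>a i\<bar>\<^sup>2 \<le> b\<^sup>2"
      using assms(2)[OF \<open>i \<in> I\<close>] by (intro power_mono) auto
    then have "(t * a i)\<^sup>2 \<le> t\<^sup>2 * b\<^sup>2"
      by (simp add: power_mult_distrib mult_left_mono)
    then have "exp ((t * a i)\<^sup>2 / 2) \<le> exp (t\<^sup>2 * b\<^sup>2 / 2)"
      by simp
    with cosh_le_exp_half_square[of "t * a i"]
    show "2 * cosh (t * a i) \<le> 2 * exp (t\<^sup>2 * b\<^sup>2 / 2)"
      by linarith
  qed simp
  also have "\<dots> = 2 ^ card I * exp (t\<^sup>2 * real (card I) * b\<^sup>2 / 2)"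
    by (simp add: power_mult_distrib field_simps flip: exp_of_nat_mult)
  finally show ?thesis .
qed

text \<open>Exponential moment method: \<open>exp\<close> of the maximum is at most the sum of the
  exponentials, where the absolute value contributes both signs and hence the factor 2 beside
  \<open>card J\<close>. The parameter \<open>t\<close> stays free, to be optimised later.\<close>

lemma Rademacher_maximal_inequality:
  fixes a :: "'j \<Rightarrow> 'i \<Rightarrow> real"
  assumes "finite I" "finite J" "J \<noteq> {}" "t > 0"
    and a: "\<And>j i. j \<in> J \<Longrightarrow> i \<in> I \<Longrightarrow> \<bar>a j i\<bar> \<le> b"
  shows "t * ((\<Sum>\<epsilon>\<in>sign_vectors I. MAX j\<in>J. \<bar>\<Sum>i\<in>I. \<epsilon> i * a j i\<bar>) / 2 ^ card I)
           \<le> ln (2 * real (card J)) + t\<^sup>2 * real (card I) * b\<^sup>2 / 2"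
proof -
  define S where "S \<epsilon> j = (\<Sum>i\<in>I. \<epsilon> i * a j i)" for \<epsilon> j
  define X where "X \<epsilon> = (MAX j\<in>J. \<bar>S \<epsilon> j\<bar>)" for \<epsilon>
  define B where "B = exp (t\<^sup>2 * real (card I) * b\<^sup>2 / 2)"
  \<comment> \<open>\<open>C\<close> will bound the average of \<open>exp (t * X \<epsilon>)\<close>
    over the sign vectors.\<close>
  define C where "C = 2 * real (card J) * B"
  have card: "card J > 0"
    using assms by (simp add: card_gt_0_iff)
  have "C > 0"
    using card by (simp add: C_def B_def)
  have exp_X: "exp (t * X \<epsilon>) \<le> (\<Sum>j\<in>J. exp (t * S \<epsilon> j) + exp ((- t) * S \<epsilon> j))" for \<epsilon>
  proof -
    have "X \<epsilon> \<in> (\<lambda>j. \<bar>S \<epsilon> j\<bar>) ` J"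
      unfolding X_def using assms by (intro Max_in) auto
    then obtain j where j: "j \<in> J" "X \<epsilon> = \<bar>S \<epsilon> j\<bar>"
      by auto
    have "exp (t * X \<epsilon>) \<le> exp (t * S \<epsilon> j) + exp ((- t) * S \<epsilon> j)"
      unfolding j by (simp add: abs_if)
    also have "\<dots> \<le> (\<Sum>j\<in>J. exp (t * S \<epsilon> j) + exp ((- t) * S \<epsilon> j))"
      using assms j by (intro member_le_sum) (auto intro: add_nonneg_nonneg)
    finally show ?thesis .
  qed
  have "(\<Sum>\<epsilon>\<in>sign_vectors I. exp (t * X \<epsilon>))
      \<le> (\<Sum>\<epsilon>\<in>sign_vectors I. \<Sum>j\<in>J. exp (t * S \<epsilon> j) + exp ((- t) * S \<epsilon> j))"
    by (intro sum_mono exp_X)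
  also have "\<dots> = (\<Sum>j\<in>J. (\<Sum>\<epsilon>\<in>sign_vectors I. exp (t * S \<epsilon> j))
                         + (\<Sum>\<epsilon>\<in>sign_vectors I. exp ((- t) * S \<epsilon> j)))"
    by (subst sum.swap) (simp add: sum.distrib)
  also have "\<dots> \<le> (\<Sum>j\<in>J. 2 ^ card I * B + 2 ^ card I * B)"
  proof (intro sum_mono add_mono)
    fix j assume "j \<in> J"
    then have "\<And>i. i \<in> I \<Longrightarrow> \<bar>a j i\<bar> \<le> b"
      by (rule a)
    note * = sum_sign_vectors_exp_le[OF assms(1) this]
    show "(\<Sum>\<epsilon>\<in>sign_vectors I. exp (t * S \<epsilon> j)) \<le> 2 ^ card I * B"
      using *[where t = t] by (simp add: S_def B_def)
    show "(\<Sum>\<epsilon>\<in>sign_vectors I. exp ((- t) * S \<epsilon> j)) \<le> 2 ^ card I * B"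
      using *[where t = "- t"] by (simp add: S_def B_def)
  qed
  also have "\<dots> = 2 ^ card I * C"
    by (simp add: C_def)
  finally have sum_exp: "(\<Sum>\<epsilon>\<in>sign_vectors I. exp (t * X \<epsilon>)) \<le> 2 ^ card I * C" .
  \<comment> \<open>The tangent line of \<open>exp\<close> at \<open>ln C\<close> replaces Jensen's inequality.\<close>
  have tangent: "t * X \<epsilon> \<le> ln C + exp (t * X \<epsilon>) / C - 1" for \<epsilon>
    using exp_ge_add_one_self[of "t * X \<epsilon> - ln C"] \<open>C > 0\<close> by (simp add: exp_diff)
  have "(\<Sum>\<epsilon>\<in>sign_vectors I. t * X \<epsilon>)
      \<le> (\<Sum>\<epsilon>\<in>sign_vectors I. ln C + exp (t * X \<epsilon>) / C - 1)"
    by (intro sum_mono tangent)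
  also have "\<dots> = 2 ^ card I * (ln C - 1) + (\<Sum>\<epsilon>\<in>sign_vectors I. exp (t * X \<epsilon>)) / C"
    using assms(1)
    by (simp add: sum.distrib sum_subtractf card_sign_vectors sum_divide_distrib algebra_simps)
  also have "\<dots> \<le> 2 ^ card I * (ln C - 1) + 2 ^ card I"
    using sum_exp \<open>C > 0\<close> by (simp add: pos_divide_le_eq)
  also have "\<dots> = 2 ^ card I * ln C"
    by (simp add: algebra_simps)
  finally have "t * (\<Sum>\<epsilon>\<in>sign_vectors I. X \<epsilon>) \<le> 2 ^ card I * ln C"
    by (simp add: sum_distrib_left)
  then have "t * ((\<Sum>\<epsilon>\<in>sign_vectors I. X \<epsilon>) / 2 ^ card I) \<le> ln C"
    by (simp add: field_simps)
  also have "ln C = ln (2 * real (card J)) + t\<^sup>2 * real (card I) * b\<^sup>2 / 2"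
    using card by (simp add: C_def B_def ln_mult)
  finally show ?thesis
    by (simp add: X_def S_def)
qed

lemma Rademacher_maximal_inequality_sqrt:
  fixes a :: "'j \<Rightarrow> 'i \<Rightarrow> real"
  assumes "finite I" "I \<noteq> {}" "finite J" "J \<noteq> {}"
    and a: "\<And>j i. j \<in> J \<Longrightarrow> i \<in> I \<Longrightarrow> \<bar>a j i\<bar> \<le> b"
  shows "(\<Sum>\<epsilon>\<in>sign_vectors I. MAX j\<in>J. \<bar>\<Sum>i\<in>I. \<epsilon> i * a j i\<bar>) / 2 ^ card I
           \<le> b * sqrt (2 * real (card I) * ln (2 * real (card J)))"
    (is "?A \<le> _")
proof -
  obtain i j where ij: "i \<in> I" "j \<in> J"
    using assms by auto
  have "b \<ge> 0"
    using a[OF ij(2,1)] by linarith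
  define L where "L = ln (2 * real (card J))"
  define n where "n = real (card I)"
  have "card J > 0" "card I > 0"
    using assms by (simp_all add: card_gt_0_iff)
  then have "L > 0" "n > 0"
    by (simp_all add: L_def n_def)
  show ?thesis
  proof (cases "b = 0")
    \<comment> \<open>For \<open>b = 0\<close> there is no optimal \<open>t\<close>, but all the
      sums vanish.\<close>
    case True
    have "(MAX j\<in>J. \<bar>\<Sum>i\<in>I. \<epsilon> i * a j i\<bar>) = 0" for \<epsilon>
      using a True assms(4) by (simp add: image_constant_conv)
    then show ?thesis
      using True by simp
  next
    case False
    with \<open>b \<ge> 0\<close> have "b > 0"
      by simp
    \<comment> \<open>This \<open>t\<close> minimises \<open>L / t + t * n * b\<^sup>2 / 2\<close>,
      the bound after division by \<open>t\<close>; its two terms are then equal.\<close>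
    define t where "t = sqrt (2 * L / n) / b"
    have "t > 0"
      using \<open>L > 0\<close> \<open>n > 0\<close> \<open>b > 0\<close> by (simp add: t_def)
    have sq: "t\<^sup>2 * n * b\<^sup>2 / 2 = L"
      using \<open>L > 0\<close> \<open>n > 0\<close> \<open>b > 0\<close> by (simp add: t_def power_divide)
    have "t * ?A \<le> L + t\<^sup>2 * n * b\<^sup>2 / 2"
      unfolding L_def n_def
      by (rule Rademacher_maximal_inequality) (use assms a \<open>t > 0\<close> in auto)
    also have "\<dots> = t * (b * sqrt (2 * n * L))"
    proof -
      have "sqrt (2 * L / n) * sqrt (2 * n * L) = sqrt ((2 * L)\<^sup>2)"
        using \<open>n > 0\<close> by (simp add: power2_eq_square flip: real_sqrt_mult)
      also have "\<dots> = 2 * L"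
        using \<open>L > 0\<close> by (intro real_sqrt_unique) auto
      finally have "t * (b * sqrt (2 * n * L)) = 2 * L"
        using \<open>b > 0\<close> by (simp add: t_def)
      then show ?thesis
        by (simp add: sq)
    qed
    finally show ?thesis
      unfolding L_def n_def using \<open>t > 0\<close> by (rule mult_left_le_imp_le)
  qed
qed

section \<open>Covers and entropy\<close>

text \<open>Cauchy-Schwarz against the constant vector 1: the mean absolute difference is at most
  the root mean square difference.\<close>

lemma emp_dist_le_imp_mean_le:
  assumes "emp_dist l n z w w' \<le> \<delta>"
  shows "(\<Sum>i=1..n. \<bar>l (z i) w - l (z i) w'\<bar>) \<le> real n * \<delta>"
proof (cases "n = 0")
  case False
  define d where "d i = \<bar>l (z i) w - l (z i) w'\<bar>" for i
  have "(\<Sum>i=1..n. d i) = (\<Sum>i=1..n. \<bar>d i\<bar> * \<bar>1\<bar>)"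
    by (simp add: d_def)
  also have "\<dots> \<le> L2_set d {1..n} * L2_set (\<lambda>_. 1) {1..n}"
    using L2_set_mult_ineq[of d "\<lambda>_. 1" "{1..n}"] by simp
  also have "\<dots> = real n * emp_dist l n z w w'"
    using False
    by (simp add: L2_set_def emp_dist_def d_def real_sqrt_divide field_simps)
  also have "\<dots> \<le> real n * \<delta>"
    using assms by (intro mult_left_mono) auto
  finally show ?thesis
    by (simp add: d_def)
qed simp

text \<open>A finite infimum in \<open>enat\<close> comes from a nonempty set and, by well-ordering,
  is attained; so the covering number itself has a cover of that size.\<close>

lemma covering_numberE:
  assumes "covering_number l W n z \<delta> = enat N"
  obtains c where "1 \<le> N" "\<And>j. j \<in> {1..N} \<Longrightarrow> c j \<in> W"
    "\<And>w. w \<in> W \<Longrightarrow> \<exists>j\<in>{1..N}. emp_dist l n z w (c j) \<le> \<delta>"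
proof -
  define A where "A = {enat N | N. 1 \<le> N \<and>
       (\<exists>c. (\<forall>j\<in>{1..N}. c j \<in> W) \<and>
            (SUP w\<in>W. MIN j\<in>{1..N}. ereal (emp_dist l n z w (c j))) \<le> ereal \<delta>)}"
  have Inf: "Inf A = enat N"
    using assms by (simp add: A_def covering_number_def)
  then have "A \<noteq> {}"
    by (auto simp: Inf_enat_def)
  then have "Inf A \<in> A"
    by (metis Inf_enat_def LeastI ex_in_conv)
  then have "1 \<le> N" and "\<exists>c. (\<forall>j\<in>{1..N}. c j \<in> W) \<and>
            (SUP w\<in>W. MIN j\<in>{1..N}. ereal (emp_dist l n z w (c j))) \<le> ereal \<delta>"
    unfolding Inf by (auto simp: A_def)
  then obtain c where c: "\<And>j. j \<in> {1..N} \<Longrightarrow> c j \<in> W"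
    and le: "(SUP w\<in>W. MIN j\<in>{1..N}. ereal (emp_dist l n z w (c j))) \<le> ereal \<delta>"
    by blast
  have "\<exists>j\<in>{1..N}. emp_dist l n z w (c j) \<le> \<delta>" if "w \<in> W" for w
  proof -
    let ?D = "(\<lambda>j. ereal (emp_dist l n z w (c j))) ` {1..N}"
    have "Min ?D \<le> ereal \<delta>"
      using le that by (simp add: SUP_le_iff)
    moreover have "Min ?D \<in> ?D"
      using \<open>1 \<le> N\<close> by (intro Min_in) auto
    ultimately show ?thesis
      by auto
  qed
  with that \<open>1 \<le> N\<close> c show ?thesis
    by blast
qed

lemma metric_entropy_le_uniform_entropy:
  "n \<ge> 1 \<Longrightarrow> z \<in> {1..n} \<rightarrow>\<^sub>E space p \<Longrightarrow> metric_entropy l W n z \<delta> \<le> uniform_entropy p l W \<delta>"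
  unfolding uniform_entropy_def by (meson SUP_upper2 SUP_upper atLeast_iff)

lemma metric_entropy_finiteE:
  assumes "metric_entropy l W n z \<delta> < \<infinity>"
  obtains N where "covering_number l W n z \<delta> = enat N"
    "metric_entropy l W n z \<delta> = ereal (log 2 (real N))"
  using assms by (auto simp: metric_entropy_def split: enat.splits)

text \<open>A positive supremum is witnessed by a single dataset with positive entropy. Its covering
  number is finite and different from 1, hence at least 2, and \<open>log 2 2 = 1\<close>.\<close>

lemma uniform_entropy_ge_one:
  assumes "uniform_entropy p l W \<delta> > 0" and fin: "uniform_entropy p l W \<delta> < \<infinity>"
  shows "uniform_entropy p l W \<delta> \<ge> 1"
proof -
  obtain n z where nz: "n \<ge> 1" "z \<in> {1..n} \<rightarrow>\<^sub>E space p" and pos: "metric_entropy l W n z \<delta> > 0"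
    using assms(1) by (auto simp: uniform_entropy_def less_SUP_iff)
  note le = metric_entropy_le_uniform_entropy[OF nz, of l W \<delta>]
  obtain N where N: "covering_number l W n z \<delta> = enat N"
    "metric_entropy l W n z \<delta> = ereal (log 2 (real N))"
    using metric_entropy_finiteE le fin by (metis le_less_trans)
  have "N \<ge> 1"
    using covering_numberE[OF N(1)] by metis
  moreover have "N \<noteq> 1"
    using pos N by auto
  ultimately have "log 2 (real N) \<ge> log 2 2"
    by (subst log_le_cancel_iff) auto
  then have "1 \<le> metric_entropy l W n z \<delta>"
    by (simp add: N one_ereal_def)
  with le show ?thesis
    by (rule order_trans[rotated])
qed

section \<open>Symmetrization\<close>

text \<open>Real weights let one quantity serve both for sign vectors and for the doubled sample.
  There is no division by \<open>m\<close>, which matches the suprema in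
  \<open>measurable_class\<close>.\<close>

definition class_sup :: "('z \<Rightarrow> 'w \<Rightarrow> real) \<Rightarrow> 'w set \<Rightarrow> nat \<Rightarrow> (nat \<Rightarrow> real) \<Rightarrow> (nat \<Rightarrow> 'z) \<Rightarrow> real" where
  "class_sup l W m e z = (SUP w\<in>W. \<bar>\<Sum>i=1..m. e i * l (z i) w\<bar>)"

lemma class_sup_cong:
  assumes "\<And>w. w \<in> W \<Longrightarrow> (\<Sum>i=1..m. e i * l (z i) w) = (\<Sum>i=1..m'. e' i * l (z' i) w)"
  shows "class_sup l W m e z = class_sup l W m' e' z'"
  unfolding class_sup_def using assms by (intro SUP_cong) auto

text \<open>Pairs each sample index \<open>i\<close> with the index \<open>i + n\<close> of its
  ghost copy.\<close>

lemma sum_atLeast1_double: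
  "(\<Sum>k=1..n + n. f k) = (\<Sum>i=1..n. f i + f (i + n))" for f :: "nat \<Rightarrow> 'b :: comm_monoid_add"
proof -
  have "(\<Sum>k=1..n + n. f k) = (\<Sum>k=1..n. f k) + (\<Sum>k=1 + n..n + n. f k)"
    unfolding add.commute[of 1 n] by (rule sum.ub_add_nat) simp
  also have "(\<Sum>k=1 + n..n + n. f k) = (\<Sum>i=1..n. f (i + n))"
    by (rule sum.shift_bounds_cl_nat_ivl)
  finally show ?thesis
    by (simp add: sum.distrib)
qed

text \<open>Coordinates picked along an injection are again independent with law \<open>M\<close>.
  This serves both for permuting the doubled sample and for projecting it onto one half.\<close>

lemma (in prob_space) integral_PiM_reindex:
  fixes F :: "('i \<Rightarrow> 'a) \<Rightarrow> real"
  assumes "F \<in> borel_measurable (PiM I (\<lambda>_. M))" "inj_on f I" "f \<in> I \<rightarrow> K"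
  shows "(\<integral>x. F (\<lambda>i\<in>I. x (f i)) \<partial>PiM K (\<lambda>_. M)) = (\<integral>x. F x \<partial>PiM I (\<lambda>_. M))"
proof -
  have meas: "(\<lambda>x. \<lambda>i\<in>I. x (f i)) \<in> PiM K (\<lambda>_. M) \<rightarrow>\<^sub>M PiM I (\<lambda>_. M)"
    using assms(3) by (intro measurable_restrict measurable_component_singleton) auto
  have "distr (PiM K (\<lambda>_. M)) (PiM I (\<lambda>_. M)) (\<lambda>x. \<lambda>i\<in>I. x (f i)) = PiM I (\<lambda>_. M)"
    by (rule distr_PiM_reindex) (use assms prob_space_axioms in auto)
  then show ?thesis
    using integral_distr[OF meas assms(1)] by simp
qed

section \<open>Bounded loss classes and the exchange of sample and ghost coordinates\<close>

locale bounded_loss_class = prob_space p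
  for p :: "'z measure" +
  fixes l :: "'z \<Rightarrow> 'w \<Rightarrow> real" and W :: "'w set" and b :: real
  assumes measurable_class: "measurable_class p l W"
    and nonempty: "W \<noteq> {}"
    and bounded: "\<And>z w. z \<in> space p \<Longrightarrow> w \<in> W \<Longrightarrow> l z w \<in> {0..b}"
begin

abbreviation sample :: "nat set \<Rightarrow> (nat \<Rightarrow> 'z) measure" where
  "sample I \<equiv> PiM I (\<lambda>_. p)"

text \<open>Supplies Fubini's theorem for splitting the doubled sample into sample and ghost
  sample.\<close>

sublocale prod: product_prob_space "\<lambda>_ :: nat. p" "UNIV :: nat set"
  by unfold_locales

lemma prob_space_sample: "prob_space (sample I)"
  by (intro prob_space_PiM prob_space_axioms)

lemma abs_loss_le: "z \<in> space p \<Longrightarrow> w \<in> W \<Longrightarrow> \<bar>l z w\<bar> \<le> b"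
  using bounded by force

lemma bound_nonneg: "b \<ge> 0"
  using not_empty nonempty bounded by force

lemma measurable_loss: "w \<in> W \<Longrightarrow> (\<lambda>z. l z w) \<in> borel_measurable p"
  using measurable_class by (simp add: measurable_class_def)

lemma integrable_loss: "w \<in> W \<Longrightarrow> integrable p (\<lambda>z. l z w)"
  using measurable_loss abs_loss_le by (intro integrable_const_bound[where B = b]) auto

lemma sample_in_space: "z \<in> space (sample I) \<Longrightarrow> i \<in> I \<Longrightarrow> z i \<in> space p"
  by (auto simp: space_PiM)

text \<open>The bound is uniform in \<open>w\<close>: it makes the real supremum in
  \<open>class_sup\<close> a genuine least upper bound and later gives integrability.\<close>

lemma abs_sum_le:
  assumes "z \<in> {1..m} \<rightarrow> space p" "w \<in> W"
  shows "\<bar>\<Sum>i=1..m. e i * l (z i) w\<bar> \<le> (\<Sum>i=1..m. \<bar>e i\<bar>) * b"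
proof -
  have "\<bar>\<Sum>i=1..m. e i * l (z i) w\<bar> \<le> (\<Sum>i=1..m. \<bar>e i * l (z i) w\<bar>)"
    by (rule sum_abs)
  also have "\<dots> \<le> (\<Sum>i=1..m. \<bar>e i\<bar> * b)"
    using assms by (intro sum_mono) (auto simp: abs_mult intro!: mult_left_mono abs_loss_le)
  finally show ?thesis
    by (simp add: sum_distrib_right)
qed

lemma abs_sum_le_class_sup:
  assumes "z \<in> {1..m} \<rightarrow> space p" "w \<in> W"
  shows "\<bar>\<Sum>i=1..m. e i * l (z i) w\<bar> \<le> class_sup l W m e z"
  unfolding class_sup_def
  using abs_sum_le[OF assms(1)] assms(2) by (intro cSUP_upper bdd_aboveI2) auto

lemma class_sup_least:
  "(\<And>w. w \<in> W \<Longrightarrow> \<bar>\<Sum>i=1..m. e i * l (z i) w\<bar> \<le> c) \<Longrightarrow> class_sup l W m e z \<le> c"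
  unfolding class_sup_def using nonempty by (rule cSUP_least)

lemma abs_class_sup_le:
  assumes "z \<in> {1..m} \<rightarrow> space p"
  shows "\<bar>class_sup l W m e z\<bar> \<le> (\<Sum>i=1..m. \<bar>e i\<bar>) * b"
proof -
  obtain w where "w \<in> W"
    using nonempty by auto
  then have "0 \<le> class_sup l W m e z"
    using abs_sum_le_class_sup[OF assms, of w e] by linarith
  then show ?thesis
    using class_sup_least[OF abs_sum_le[OF assms], of e] by simp
qed

lemma measurable_class_sup [measurable]: "class_sup l W m e \<in> borel_measurable (sample {1..m})"
  using measurable_class unfolding measurable_class_def class_sup_def by blast

lemma integrable_class_sup: "integrable (sample {1..m}) (class_sup l W m e)"
proof -
  interpret S: prob_space "sample {1..m}"
    by (rule prob_space_sample)
  show ?thesis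
    using abs_class_sup_le
    by (intro S.integrable_const_bound[where B = "(\<Sum>i=1..m. \<bar>e i\<bar>) * b"] AE_I2)
      (auto simp: space_PiM PiE_def)
qed

text \<open>Indices up to \<open>n\<close> hold the sample and the next \<open>n\<close> the ghost
  sample. Unit signs give ghost losses minus sample losses; \<open>\<epsilon> i = -1\<close>
  reverses the \<open>i\<close>-th difference.\<close>

definition pair_signs :: "nat \<Rightarrow> (nat \<Rightarrow> real) \<Rightarrow> nat \<Rightarrow> real" where
  "pair_signs n \<epsilon> k = (if k \<le> n then - \<epsilon> k else \<epsilon> (k - n))"

lemma sum_pair_signs:
  "(\<Sum>k=1..n + n. pair_signs n \<epsilon> k * f k) = (\<Sum>i=1..n. \<epsilon> i * (f (i + n) - f i))"
  unfolding sum_atLeast1_double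
  by (intro sum.cong) (auto simp: pair_signs_def algebra_simps)

text \<open>Reversing the \<open>i\<close>-th difference amounts to exchanging coordinates
  \<open>i\<close> and \<open>i + n\<close>, and the product measure is invariant under such
  exchanges.\<close>

lemma integral_class_sup_pair_signs:
  assumes "\<And>i. i \<in> {1..n} \<Longrightarrow> \<epsilon> i \<in> {-1, 1}"
  shows "(\<integral>x. class_sup l W (n + n) (pair_signs n \<epsilon>) x \<partial>sample {1..n + n})
       = (\<integral>x. class_sup l W (n + n) (pair_signs n (\<lambda>_. 1)) x \<partial>sample {1..n + n})"
proof -
  \<comment> \<open>The permutation exchanges \<open>i\<close> and \<open>i + n\<close> exactly
    where \<open>\<epsilon> i\<close> is not 1.\<close>
  define \<pi> where "\<pi> k = (if k \<le> n then if \<epsilon> k = 1 then k else k + n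
                         else if \<epsilon> (k - n) = 1 then k else k - n)" for k
  have "inj_on \<pi> {1..n + n}" "\<pi> \<in> {1..n + n} \<rightarrow> {1..n + n}"
    by (auto simp: \<pi>_def inj_on_def split: if_splits)
  then have "(\<integral>x. class_sup l W (n + n) (pair_signs n (\<lambda>_. 1)) x \<partial>sample {1..n + n})
    = (\<integral>x. class_sup l W (n + n) (pair_signs n (\<lambda>_. 1)) (\<lambda>k\<in>{1..n + n}. x (\<pi> k))
          \<partial>sample {1..n + n})"
    by (intro integral_PiM_reindex[symmetric] measurable_class_sup)
  also have "\<dots> = (\<integral>x. class_sup l W (n + n) (pair_signs n \<epsilon>) x \<partial>sample {1..n + n})"
  proof (intro Bochner_Integration.integral_cong refl class_sup_cong)
    fix x :: "nat \<Rightarrow> 'z" and w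
    show "(\<Sum>k=1..n + n. pair_signs n (\<lambda>_. 1) k * l ((\<lambda>k\<in>{1..n + n}. x (\<pi> k)) k) w)
        = (\<Sum>k=1..n + n. pair_signs n \<epsilon> k * l (x k) w)"
      unfolding sum_pair_signs using assms
      by (intro sum.cong) (force simp: \<pi>_def)+
  qed
  finally show ?thesis
    by simp
qed

text \<open>The triangle inequality separates the two halves, and each half has the law of a sample
  of size \<open>n\<close>; hence the factor 2.\<close>

lemma integral_class_sup_pair_signs_le:
  "(\<integral>x. class_sup l W (n + n) (pair_signs n \<epsilon>) x \<partial>sample {1..n + n})
     \<le> 2 * (\<integral>z. class_sup l W n \<epsilon> z \<partial>sample {1..n})"
proof -
  \<comment> \<open>The restrictions yield points of the product space over \<open>{1..n}\<close>,
    where \<open>class_sup\<close> is measurable.\<close>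
  define F G where "F x = class_sup l W n \<epsilon> (\<lambda>i\<in>{1..n}. x i)"
    and "G x = class_sup l W n \<epsilon> (\<lambda>i\<in>{1..n}. x (i + n))" for x
  interpret S: prob_space "sample {1..n + n}"
    by (rule prob_space_sample)
  have meas: "F \<in> borel_measurable (sample {1..n + n})" "G \<in> borel_measurable (sample {1..n + n})"
    unfolding F_def G_def
    by (auto intro!: measurable_compose[OF _ measurable_class_sup] measurable_restrict
        measurable_component_singleton)
  have bound: "\<bar>F x\<bar> \<le> (\<Sum>i=1..n. \<bar>\<epsilon> i\<bar>) * b" "\<bar>G x\<bar> \<le> (\<Sum>i=1..n. \<bar>\<epsilon> i\<bar>) * b"
    if "x \<in> space (sample {1..n + n})" for x
    unfolding F_def G_def using sample_in_space[OF that] by (auto intro!: abs_class_sup_le)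
  have int: "integrable (sample {1..n + n}) F" "integrable (sample {1..n + n}) G"
    using meas bound
    by (auto intro!: S.integrable_const_bound[where B = "(\<Sum>i=1..n. \<bar>\<epsilon> i\<bar>) * b"])
  have "(\<integral>x. class_sup l W (n + n) (pair_signs n \<epsilon>) x \<partial>sample {1..n + n})
      \<le> (\<integral>x. F x + G x \<partial>sample {1..n + n})"
  proof (intro integral_mono integrable_class_sup Bochner_Integration.integrable_add int
      class_sup_least)
    fix x w assume x: "x \<in> space (sample {1..n + n})" and w: "w \<in> W"
    have "(\<Sum>k=1..n + n. pair_signs n \<epsilon> k * l (x k) w)
        = (\<Sum>i=1..n. \<epsilon> i * l (x (i + n)) w) - (\<Sum>i=1..n. \<epsilon> i * l (x i) w)"
      unfolding sum_pair_signs by (simp add: algebra_simps sum_subtractf)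
    moreover have "\<bar>\<Sum>i=1..n. \<epsilon> i * l (x i) w\<bar> \<le> F x"
      using abs_sum_le_class_sup[of "\<lambda>i\<in>{1..n}. x i" n w \<epsilon>] sample_in_space[OF x] w
      by (auto simp: F_def)
    moreover have "\<bar>\<Sum>i=1..n. \<epsilon> i * l (x (i + n)) w\<bar> \<le> G x"
      using abs_sum_le_class_sup[of "\<lambda>i\<in>{1..n}. x (i + n)" n w \<epsilon>] sample_in_space[OF x] w
      by (auto simp: G_def)
    ultimately show "\<bar>\<Sum>k=1..n + n. pair_signs n \<epsilon> k * l (x k) w\<bar> \<le> F x + G x"
      by linarith
  qed
  also have "\<dots> = (\<integral>x. F x \<partial>sample {1..n + n}) + (\<integral>x. G x \<partial>sample {1..n + n})"
    by (intro Bochner_Integration.integral_add int)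
  also have "(\<integral>x. F x \<partial>sample {1..n + n}) = (\<integral>z. class_sup l W n \<epsilon> z \<partial>sample {1..n})"
    unfolding F_def by (intro integral_PiM_reindex measurable_class_sup) auto
  also have "(\<integral>x. G x \<partial>sample {1..n + n}) = (\<integral>z. class_sup l W n \<epsilon> z \<partial>sample {1..n})"
    unfolding G_def by (intro integral_PiM_reindex measurable_class_sup) auto
  finally show ?thesis
    by simp
qed

section \<open>Comparison with an independent ghost sample\<close>

lemma integral_loss_component:
  assumes "i \<in> I" "w \<in> W"
  shows "integrable (sample I) (\<lambda>y. l (y i) w)"
    and "(\<integral>y. l (y i) w \<partial>sample I) = expected_loss p l w"
proof -
  have distr: "distr (sample I) p (\<lambda>y. y i) = p"
    by (rule distr_PiM_component) (use assms prob_space_axioms in auto)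
  have comp: "(\<lambda>y. y i) \<in> sample I \<rightarrow>\<^sub>M p"
    using assms(1) by (rule measurable_component_singleton)
  show "integrable (sample I) (\<lambda>y. l (y i) w)"
    using integrable_distr[OF comp] integrable_loss[OF assms(2)] by (simp add: distr)
  show "(\<integral>y. l (y i) w \<partial>sample I) = expected_loss p l w"
    using integral_distr[OF comp measurable_loss[OF assms(2)]]
    by (simp add: distr expected_loss_def)
qed

lemma abs_expected_loss_le: "w \<in> W \<Longrightarrow> \<bar>expected_loss p l w\<bar> \<le> b"
  unfolding expected_loss_def using bounded
  by (auto intro!: integral_nonneg_AE integral_le_const integrable_loss simp: abs_le_iff
      intro: order_trans[OF _ bound_nonneg])

lemma abs_loss_gap_le:
  assumes "n \<ge> 1" "z \<in> {1..n} \<rightarrow> space p" "w \<in> W"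
  shows "\<bar>expected_loss p l w - empirical_loss l n z w\<bar> \<le> 2 * b"
proof -
  have "\<bar>\<Sum>i=1..n. 1 * l (z i) w\<bar> \<le> (\<Sum>i=1..n. \<bar>1\<bar>) * b"
    using assms by (intro abs_sum_le) auto
  then have "\<bar>empirical_loss l n z w\<bar> \<le> b"
    using assms(1) by (simp add: empirical_loss_def abs_mult field_simps)
  with abs_expected_loss_le[OF assms(3)] show ?thesis
    by linarith
qed

lemma abs_gen_error_le:
  assumes "n \<ge> 1" "z \<in> {1..n} \<rightarrow> space p"
  shows "\<bar>gen_error p l W n z\<bar> \<le> 2 * b"
proof -
  obtain w where "w \<in> W"
    using nonempty by auto
  have "0 \<le> \<bar>expected_loss p l w - empirical_loss l n z w\<bar>"
    by simp
  also have "\<dots> \<le> gen_error p l W n z"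
    unfolding gen_error_def using abs_loss_gap_le[OF assms] \<open>w \<in> W\<close>
    by (intro cSUP_upper bdd_aboveI2) auto
  finally have "0 \<le> gen_error p l W n z" .
  moreover have "gen_error p l W n z \<le> 2 * b"
    unfolding gen_error_def using abs_loss_gap_le[OF assms] nonempty by (intro cSUP_least) auto
  ultimately show ?thesis
    by simp
qed

text \<open>
  Conditionally on the sample \<open>x\<close>, the expected loss is the mean of the empirical loss of an
  independent ghost sample \<open>y\<close>, so the supremum may be pulled inside the integral over \<open>y\<close>.
\<close>

lemma gen_error_le_ghost:
  assumes n: "n \<ge> 1" and x: "x \<in> space (sample {1..n})"
    and int: "integrable (sample {1 + n..n + n})
      (\<lambda>y. class_sup l W (n + n) (pair_signs n (\<lambda>_. 1)) (merge {1..n} {1 + n..n + n} (x, y)))"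
  shows "real n * gen_error p l W n x \<le>
    (\<integral>y. class_sup l W (n + n) (pair_signs n (\<lambda>_. 1)) (merge {1..n} {1 + n..n + n} (x, y))
       \<partial>sample {1 + n..n + n})"
    (is "_ \<le> ?R")
proof -
  let ?J = "{1 + n..n + n}"
  interpret J: prob_space "sample ?J"
    by (rule prob_space_sample)
  have "\<bar>expected_loss p l w - empirical_loss l n x w\<bar> \<le> ?R / n" if w: "w \<in> W" for w
  proof -
    have int_l: "integrable (sample ?J) (\<lambda>y. l (y (i + n)) w - l (x i) w)" if "i \<in> {1..n}" for i
      using that w by (intro Bochner_Integration.integrable_diff integral_loss_component) auto
    have "real n * (expected_loss p l w - empirical_loss l n x w)
        = (\<Sum>i=1..n. expected_loss p l w - l (x i) w)"
      using n by (simp add: empirical_loss_def sum_subtractf right_diff_distrib)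
    \<comment> \<open>The ghost coordinate \<open>y (i + n)\<close> has law \<open>p\<close>, while
      \<open>l (x i) w\<close> is constant in \<open>y\<close> and the ghost measure has total mass
      1.\<close>
    also have "\<dots> = (\<Sum>i=1..n. \<integral>y. l (y (i + n)) w - l (x i) w \<partial>sample ?J)"
    proof (intro sum.cong refl)
      fix i assume "i \<in> {1..n}"
      then have "i + n \<in> ?J"
        by auto
      note * = integral_loss_component[OF this w]
      show "expected_loss p l w - l (x i) w = (\<integral>y. l (y (i + n)) w - l (x i) w \<partial>sample ?J)"
        by (subst Bochner_Integration.integral_diff)
          (use * in \<open>simp_all add: J.prob_space\<close>)
    qed
    also have "\<dots> = (\<integral>y. (\<Sum>i=1..n. l (y (i + n)) w - l (x i) w) \<partial>sample ?J)"
      by (intro Bochner_Integration.integral_sum[symmetric] int_l)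
    finally have "real n * \<bar>expected_loss p l w - empirical_loss l n x w\<bar>
        = \<bar>\<integral>y. (\<Sum>i=1..n. l (y (i + n)) w - l (x i) w) \<partial>sample ?J\<bar>"
      by (metis abs_mult abs_of_nat)
    also have "\<dots> \<le> (\<integral>y. \<bar>\<Sum>i=1..n. l (y (i + n)) w - l (x i) w\<bar> \<partial>sample ?J)"
      by (rule integral_abs_bound)
    also have "\<dots> \<le> ?R"
    proof (intro integral_mono int integrable_abs Bochner_Integration.integrable_sum int_l)
      fix y assume y: "y \<in> space (sample ?J)"
      let ?m = "merge {1..n} ?J (x, y)"
      have eq: "?m i = x i" "?m (i + n) = y (i + n)" if "i \<in> {1..n}" for i
        using that by (auto simp: merge_def)
      have "?m \<in> {1..n + n} \<rightarrow> space p"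
        using sample_in_space[OF x] sample_in_space[OF y] by (auto simp: merge_def)
      then have "\<bar>\<Sum>k=1..n + n. pair_signs n (\<lambda>_. 1) k * l (?m k) w\<bar>
          \<le> class_sup l W (n + n) (pair_signs n (\<lambda>_. 1)) ?m"
        by (intro abs_sum_le_class_sup w)
      also have "(\<Sum>k=1..n + n. pair_signs n (\<lambda>_. 1) k * l (?m k) w)
          = (\<Sum>i=1..n. l (y (i + n)) w - l (x i) w)"
        unfolding sum_pair_signs by (intro sum.cong) (simp_all add: eq)
      finally show "\<bar>\<Sum>i=1..n. l (y (i + n)) w - l (x i) w\<bar>
          \<le> class_sup l W (n + n) (pair_signs n (\<lambda>_. 1)) ?m" .
    qed
    finally show ?thesis
      using n by (simp add: field_simps)
  qed
  then have "gen_error p l W n x \<le> ?R / n"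
    unfolding gen_error_def using nonempty by (intro cSUP_least)
  then show ?thesis
    using n by (simp add: field_simps)
qed

text \<open>Integrates the bound for a fixed sample over that sample; Fubini then merges the two
  integrals into one over the doubled sample.\<close>

lemma integral_gen_error_le_ghost:
  assumes n: "n \<ge> 1" and meas: "gen_error p l W n \<in> borel_measurable (sample {1..n})"
  shows "real n * (\<integral>z. gen_error p l W n z \<partial>sample {1..n})
    \<le> (\<integral>x. class_sup l W (n + n) (pair_signs n (\<lambda>_. 1)) x \<partial>sample {1..n + n})"
proof -
  let ?I = "{1..n}" and ?J = "{1 + n..n + n}" and ?s = "pair_signs n (\<lambda>_. 1)"
  define F where "F x y = class_sup l W (n + n) ?s (merge ?I ?J (x, y))" for x y
  \<comment> \<open>A uniform bound on \<open>F\<close>; with measurability it gives integrability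
    of the sections and of the inner integral.\<close>
  define B where "B = (\<Sum>i=1..n + n. \<bar>?s i\<bar>) * b"
  have IJ: "?I \<union> ?J = {1..n + n}" "?I \<inter> ?J = {}"
    by auto
  interpret I: prob_space "sample ?I"
    by (rule prob_space_sample)
  interpret J: prob_space "sample ?J"
    by (rule prob_space_sample)
  have "merge ?I ?J \<in> sample ?I \<Otimes>\<^sub>M sample ?J \<rightarrow>\<^sub>M sample {1..n + n}"
    using measurable_merge[of ?I ?J "\<lambda>_. p"] by (simp only: IJ)
  from measurable_compose[OF this measurable_class_sup]
  have F [measurable]: "case_prod F \<in> borel_measurable (sample ?I \<Otimes>\<^sub>M sample ?J)"
    by (simp add: F_def case_prod_beta')
  have bound: "\<bar>F x y\<bar> \<le> B" if "x \<in> space (sample ?I)" "y \<in> space (sample ?J)" for x y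
    unfolding F_def B_def using sample_in_space[OF that(1)] sample_in_space[OF that(2)]
    by (intro abs_class_sup_le) (auto simp: merge_def)
  have int: "integrable (sample ?J) (F x)" if "x \<in> space (sample ?I)" for x
    using bound[OF that] measurable_Pair2[OF F that] by (intro J.integrable_const_bound[where B = B]) auto
  have bound_int: "\<bar>\<integral>y. F x y \<partial>sample ?J\<bar> \<le> B" if x: "x \<in> space (sample ?I)" for x
  proof -
    have "\<bar>\<integral>y. F x y \<partial>sample ?J\<bar> \<le> (\<integral>y. \<bar>F x y\<bar> \<partial>sample ?J)"
      by (rule integral_abs_bound)
    also have "\<dots> \<le> B"
      using int[OF x] bound[OF x] by (intro J.integral_le_const) auto
    finally show ?thesis .
  qed
  have "real n * (\<integral>z. gen_error p l W n z \<partial>sample ?I)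
      = (\<integral>z. real n * gen_error p l W n z \<partial>sample ?I)"
    by simp
  also have "\<dots> \<le> (\<integral>x. \<integral>y. F x y \<partial>sample ?J \<partial>sample ?I)"
  proof (rule integral_mono)
    \<comment> \<open>Monotonicity of the Bochner integral requires integrability on both sides;
      this is where measurability of the generalization error enters.\<close>
    have "integrable (sample ?I) (gen_error p l W n)"
      using abs_gen_error_le[OF n] meas sample_in_space
      by (intro I.integrable_const_bound[where B = "2 * b"]) (auto simp: Pi_def)
    then show "integrable (sample ?I) (\<lambda>z. real n * gen_error p l W n z)"
      by simp
    show "integrable (sample ?I) (\<lambda>x. \<integral>y. F x y \<partial>sample ?J)"
      using bound_int J.borel_measurable_lebesgue_integral[OF F]
      by (intro I.integrable_const_bound[where B = B]) auto
    show "real n * gen_error p l W n x \<le> (\<integral>y. F x y \<partial>sample ?J)"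
      if "x \<in> space (sample ?I)" for x
      using gen_error_le_ghost[OF n that int[OF that, unfolded F_def]] by (simp add: F_def)
  qed
  also have "\<dots> = (\<integral>x. class_sup l W (n + n) ?s x \<partial>sample (?I \<union> ?J))"
    unfolding F_def using IJ integrable_class_sup[of "n + n" ?s]
    by (intro prod.product_integral_fold[symmetric]) (simp_all only: finite_atLeastAtMost)
  finally show ?thesis
    by (simp only: IJ)
qed

text \<open>The bound holds for every fixed sign vector, because the ghost integral does not depend
  on the signs; averaging over all \<open>2 ^ n\<close> of them gives the claim.\<close>

lemma symmetrization:
  assumes "n \<ge> 1" and "gen_error p l W n \<in> borel_measurable (sample {1..n})"
  shows "real n * (\<integral>z. gen_error p l W n z \<partial>sample {1..n})
    \<le> 2 * (\<integral>z. (\<Sum>\<epsilon>\<in>sign_vectors {1..n}. class_sup l W n \<epsilon> z) / 2 ^ n \<partial>sample {1..n})"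
proof -
  let ?G = "real n * (\<integral>z. gen_error p l W n z \<partial>sample {1..n})"
  have "?G \<le> 2 * (\<integral>z. class_sup l W n \<epsilon> z \<partial>sample {1..n})" if "\<epsilon> \<in> sign_vectors {1..n}" for \<epsilon>
  proof -
    have "?G \<le> (\<integral>x. class_sup l W (n + n) (pair_signs n \<epsilon>) x \<partial>sample {1..n + n})"
      using integral_gen_error_le_ghost[OF assms] integral_class_sup_pair_signs[OF PiE_mem[OF that]]
      by simp
    also note integral_class_sup_pair_signs_le
    finally show ?thesis .
  qed
  then have "(\<Sum>\<epsilon>\<in>sign_vectors {1..n}. ?G)
      \<le> (\<Sum>\<epsilon>\<in>sign_vectors {1..n}. 2 * (\<integral>z. class_sup l W n \<epsilon> z \<partial>sample {1..n}))"
    by (rule sum_mono)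
  also have "\<dots> = 2 * (\<integral>z. (\<Sum>\<epsilon>\<in>sign_vectors {1..n}. class_sup l W n \<epsilon> z) \<partial>sample {1..n})"
    by (subst Bochner_Integration.integral_sum) (simp_all add: integrable_class_sup sum_distrib_left)
  finally show ?thesis
    by (simp add: card_sign_vectors field_simps)
qed

section \<open>The entropy bound\<close>

text \<open>Replacing \<open>w\<close> by a nearby centre changes each signed sum by at most
  \<open>real n * \<delta>\<close>, which leaves a maximum over \<open>N\<close> centres. The
  factors \<open>n\<close> appear because \<open>class_sup\<close> is a sum and not a mean.\<close>

lemma Rademacher_average_le:
  assumes n: "n \<ge> 1" and z: "z \<in> {1..n} \<rightarrow> space p"
    and N: "covering_number l W n z \<delta> = enat N"
  shows "(\<Sum>\<epsilon>\<in>sign_vectors {1..n}. class_sup l W n \<epsilon> z) / 2 ^ n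
    \<le> real n * \<delta> + b * sqrt (2 * real n * ln (2 * real N))"
proof -
  obtain c where "1 \<le> N" and c: "\<And>j. j \<in> {1..N} \<Longrightarrow> c j \<in> W"
    and cover: "\<And>w. w \<in> W \<Longrightarrow> \<exists>j\<in>{1..N}. emp_dist l n z w (c j) \<le> \<delta>"
    using covering_numberE[OF N] by metis
  define T where "T \<epsilon> = (MAX j\<in>{1..N}. \<bar>\<Sum>i=1..n. \<epsilon> i * l (z i) (c j)\<bar>)" for \<epsilon>
  have "class_sup l W n \<epsilon> z \<le> real n * \<delta> + T \<epsilon>" if \<epsilon>: "\<epsilon> \<in> sign_vectors {1..n}" for \<epsilon>
  proof (rule class_sup_least)
    fix w assume "w \<in> W"
    then obtain j where j: "j \<in> {1..N}" "emp_dist l n z w (c j) \<le> \<delta>"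
      using cover by blast
    have "\<bar>(\<Sum>i=1..n. \<epsilon> i * l (z i) w) - (\<Sum>i=1..n. \<epsilon> i * l (z i) (c j))\<bar>
        = \<bar>\<Sum>i=1..n. \<epsilon> i * (l (z i) w - l (z i) (c j))\<bar>"
      by (simp add: sum_subtractf right_diff_distrib)
    also have "\<dots> \<le> (\<Sum>i=1..n. \<bar>\<epsilon> i * (l (z i) w - l (z i) (c j))\<bar>)"
      by (rule sum_abs)
    \<comment> \<open>Signs have absolute value 1.\<close>
    also have "\<dots> = (\<Sum>i=1..n. \<bar>l (z i) w - l (z i) (c j)\<bar>)"
      using PiE_mem[OF \<epsilon>] by (intro sum.cong) (fastforce simp: abs_mult)+
    also have "\<dots> \<le> real n * \<delta>"
      using j(2) by (rule emp_dist_le_imp_mean_le)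
    finally have "\<bar>(\<Sum>i=1..n. \<epsilon> i * l (z i) w) - (\<Sum>i=1..n. \<epsilon> i * l (z i) (c j))\<bar> \<le> real n * \<delta>" .
    moreover have "\<bar>\<Sum>i=1..n. \<epsilon> i * l (z i) (c j)\<bar> \<le> T \<epsilon>"
      unfolding T_def using j(1) by (intro Max_ge) auto
    ultimately show "\<bar>\<Sum>i=1..n. \<epsilon> i * l (z i) w\<bar> \<le> real n * \<delta> + T \<epsilon>"
      by linarith
  qed
  then have "(\<Sum>\<epsilon>\<in>sign_vectors {1..n}. class_sup l W n \<epsilon> z)
      \<le> (\<Sum>\<epsilon>\<in>sign_vectors {1..n}. real n * \<delta> + T \<epsilon>)"
    by (rule sum_mono)
  also have "\<dots> = 2 ^ n * (real n * \<delta>) + (\<Sum>\<epsilon>\<in>sign_vectors {1..n}. T \<epsilon>)"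
    by (simp add: sum.distrib card_sign_vectors)
  finally have "(\<Sum>\<epsilon>\<in>sign_vectors {1..n}. class_sup l W n \<epsilon> z) / 2 ^ n
      \<le> real n * \<delta> + (\<Sum>\<epsilon>\<in>sign_vectors {1..n}. T \<epsilon>) / 2 ^ n"
    by (simp add: field_simps)
  also have "(\<Sum>\<epsilon>\<in>sign_vectors {1..n}. T \<epsilon>) / 2 ^ n \<le> b * sqrt (2 * real n * ln (2 * real N))"
    using Rademacher_maximal_inequality_sqrt[of "{1..n}" "{1..N}" "\<lambda>j i. l (z i) (c j)" b]
      n \<open>1 \<le> N\<close> c z abs_loss_le
    by (auto simp: T_def Pi_iff)
  finally show ?thesis
    by simp
qed

text \<open>The uniform entropy dominates the entropy of every dataset, so the Rademacher average
  has a bound independent of \<open>z\<close>, which symmetrization turns into one for the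
  expectation.\<close>

lemma integral_gen_error_le:
  assumes n: "n \<ge> 1" and meas: "gen_error p l W n \<in> borel_measurable (sample {1..n})"
    and pos: "uniform_entropy p l W \<delta> > 0" and fin: "uniform_entropy p l W \<delta> < \<infinity>"
  shows "(\<integral>z. gen_error p l W n z \<partial>sample {1..n})
    \<le> 2 * \<delta> + 6 * b * sqrt (real_of_ereal (uniform_entropy p l W \<delta>) / real n)"
proof -
  interpret S: prob_space "sample {1..n}"
    by (rule prob_space_sample)
  obtain H where H: "uniform_entropy p l W \<delta> = ereal H"
    using pos fin by (cases "uniform_entropy p l W \<delta>") auto
  have "H \<ge> 1"
    using uniform_entropy_ge_one[OF pos fin] by (simp add: H one_ereal_def)
  have avg: "(\<Sum>\<epsilon>\<in>sign_vectors {1..n}. class_sup l W n \<epsilon> z) / 2 ^ n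
      \<le> real n * \<delta> + 3 * b * sqrt (real n * H)" if z: "z \<in> space (sample {1..n})" for z
  proof -
    have le: "metric_entropy l W n z \<delta> \<le> ereal H"
      using metric_entropy_le_uniform_entropy[OF n, of z p l W \<delta>] z by (simp add: H space_PiM)
    then obtain N where N: "covering_number l W n z \<delta> = enat N"
      "metric_entropy l W n z \<delta> = ereal (log 2 (real N))"
      using metric_entropy_finiteE by (metis PInfty_neq_ereal(1) ereal_infty_less_eq(1) less_ereal.simps(4) linorder_not_less)
    have "N \<ge> 1"
      using covering_numberE[OF N(1)] by metis
    \<comment> \<open>Base 2 against natural logarithm; \<open>ln 2 < 1\<close> and
      \<open>H \<ge> 1\<close> then give the bound \<open>2 * H\<close>.\<close>
    have "ln (2 * real N) = ln 2 * (1 + log 2 (real N))"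
      using \<open>N \<ge> 1\<close> by (simp add: ln_mult log_def field_simps)
    also have "\<dots> \<le> 1 * (1 + H)"
      using le N(2) \<open>N \<ge> 1\<close> ln_2_less_1 by (intro mult_mono) auto
    also have "\<dots> \<le> 2 * H"
      using \<open>H \<ge> 1\<close> by simp
    finally have "2 * real n * ln (2 * real N) \<le> 2 * real n * (2 * H)"
      by (intro mult_left_mono) auto
    \<comment> \<open>The coefficient 4 is rounded up to 9, whose root 3 is doubled by
      symmetrization to the constant 6.\<close>
    also have "\<dots> \<le> 3\<^sup>2 * (real n * H)"
      using \<open>H \<ge> 1\<close> by simp
    finally have "sqrt (2 * real n * ln (2 * real N)) \<le> sqrt (3\<^sup>2 * (real n * H))"
      by (rule real_sqrt_le_mono)
    then have "sqrt (2 * real n * ln (2 * real N)) \<le> 3 * sqrt (real n * H)"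
      by (simp add: real_sqrt_mult)
    then have "b * sqrt (2 * real n * ln (2 * real N)) \<le> b * (3 * sqrt (real n * H))"
      using bound_nonneg by (rule mult_left_mono)
    with Rademacher_average_le[OF n _ N(1)] sample_in_space[OF z] show ?thesis
      by (force simp: Pi_iff)
  qed
  have "real n * (\<integral>z. gen_error p l W n z \<partial>sample {1..n})
    \<le> 2 * (\<integral>z. (\<Sum>\<epsilon>\<in>sign_vectors {1..n}. class_sup l W n \<epsilon> z) / 2 ^ n \<partial>sample {1..n})"
    using n meas by (rule symmetrization)
  also have "\<dots> \<le> 2 * (real n * \<delta> + 3 * b * sqrt (real n * H))"
    using avg
    by (intro mult_left_mono S.integral_le_const AE_I2 integrable_class_sup
        Bochner_Integration.integrable_divide Bochner_Integration.integrable_sum) auto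
  \<comment> \<open>Extracts the factor \<open>n\<close> common to both sides.\<close>
  also have "sqrt (real n * H) = real n * sqrt (H / real n)"
    using n by (simp add: real_sqrt_mult real_sqrt_divide field_simps)
  finally have "real n * (\<integral>z. gen_error p l W n z \<partial>sample {1..n})
      \<le> real n * (2 * \<delta> + 6 * b * sqrt (H / real n))"
    by (simp add: algebra_simps)
  then show ?thesis
    using n by (simp add: H)
qed

end

section \<open>Transfer to i.i.d. random variables\<close>

theorem theorem0p4:
  fixes p :: "'z measure" and M :: "'a measure" and Z :: "nat \<Rightarrow> 'a \<Rightarrow> 'z"
    and l :: "'z \<Rightarrow> 'w \<Rightarrow> real" and W :: "'w set" and \<rho> :: "'w \<Rightarrow> 'w \<Rightarrow> real"
    and b :: real and n :: nat
  assumes "prob_space p"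
    and "Metric_space W \<rho>" and "W \<noteq> {}"
    and "n \<ge> 1"
    and "prob_space M"
    and "prob_space.indep_vars M (\<lambda>_. p) Z {1..n}"
    and "\<And>i. i \<in> {1..n} \<Longrightarrow> distr M p (Z i) = p"
    and "measurable_class p l W"
    and "gen_error p l W n \<in> borel_measurable (PiM {1..n} (\<lambda>_. p))"
    and loss_bounded: "\<And>z w. z \<in> space p \<Longrightarrow> w \<in> W \<Longrightarrow> l z w \<in> {0..b}"
    and entropy_finite: "\<And>\<delta>. \<delta> > 0 \<Longrightarrow> uniform_entropy p l W \<delta> < \<infinity>"
  shows "ereal (\<integral>\<omega>. gen_error p l W n (\<lambda>i. Z i \<omega>) \<partial>M)
           \<le> (INF \<delta>\<in>{\<delta>. \<delta> > 0 \<and> uniform_entropy p l W \<delta> > 0}.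
                ereal (2 * \<delta> + 6 * b * sqrt (real_of_ereal (uniform_entropy p l W \<delta>) / real n)))"
proof -
  interpret M: prob_space M
    by fact
  interpret bounded_loss_class p l W b
    using assms by (intro bounded_loss_class.intro bounded_loss_class_axioms.intro)
  have Z: "Z i \<in> M \<rightarrow>\<^sub>M p" if "i \<in> {1..n}" for i
    using assms(6) that by (auto simp: M.indep_vars_def)
  \<comment> \<open>Independence makes the joint law a product, and every factor is
    \<open>p\<close>.\<close>
  have "distr M (sample {1..n}) (\<lambda>\<omega>. \<lambda>i\<in>{1..n}. Z i \<omega>) = PiM {1..n} (\<lambda>i. distr M p (Z i))"
    using assms(4,6) Z by (subst M.indep_vars_iff_distr_eq_PiM'[symmetric]) auto
  also have "\<dots> = sample {1..n}"
    using assms(7) by (intro PiM_cong) auto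
  finally have distr: "distr M (sample {1..n}) (\<lambda>\<omega>. \<lambda>i\<in>{1..n}. Z i \<omega>) = sample {1..n}" .
  \<comment> \<open>Only coordinates in \<open>{1..n}\<close> enter the generalization error, so
    restricting to them changes nothing.\<close>
  have "(\<integral>\<omega>. gen_error p l W n (\<lambda>i. Z i \<omega>) \<partial>M)
      = (\<integral>\<omega>. gen_error p l W n (\<lambda>i\<in>{1..n}. Z i \<omega>) \<partial>M)"
    by (simp add: gen_error_def empirical_loss_def)
  also have "\<dots> = (\<integral>z. gen_error p l W n z \<partial>sample {1..n})"
    using integral_distr[of "\<lambda>\<omega>. \<lambda>i\<in>{1..n}. Z i \<omega>" M "sample {1..n}" "gen_error p l W n"]
      assms(9) Z by (simp add: distr measurable_restrict)
  \<comment> \<open>It suffices to bound the expectation for each admissible \<delta>; if there is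
    none, the infimum in \<open>ereal\<close> is \<infinity>.\<close>
  finally show ?thesis
    using integral_gen_error_le[OF assms(4,9)] entropy_finite by (auto intro!: INF_greatest)
qed

end
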